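(* For every integer $n\ge 0$, $$Ch_n=\frac{(n+1)!}{2^n}\,b_n^{(-1)}.$$
   Context: The Changhee numbers of the first kind $Ch_n$ are defined by the generating function (an identity of formal power series in $t$) $\sum_{n=0}^\infty Ch_n\frac{t^n}{n!}=\frac{2}{2+t}$. The numbers $b_n^{(-1)}$ are the Nörlund numbers of the second kind, given by the explicit formula $b_n^{(-1)}=\frac{(-1)^n}{n+1}$ for $n\ge0$. *)

theory Defs
  imports "HOL-Computational_Algebra.Formal_Power_Series"
begin

definition changhee :: "nat \<Rightarrow> real" where
  "changhee n = fact n * fps_nth (2 / (2 + fps_X)) n"

lemma changhee_egf: "Abs_fps (\<lambda>n. changhee n / fact n) = 2 / (2 + fps_X)"
  by (simp add: changhee_def fps_eq_iff)

(* Division of formal power series is total; here the divisor is a unit, so it is the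
   genuine quotient. *)
lemma changhee_egf_times: "Abs_fps (\<lambda>n. changhee n / fact n) * (2 + fps_X) = 2"
proof -
  have "fps_nth (2 + fps_X :: real fps) 0 \<noteq> 0"
    by simp
  then show ?thesis
    unfolding changhee_egf by (simp add: fps_divide_unit mult.assoc inverse_mult_eq_1)
qed

(* The Noerlund numbers of the second kind of order -1. *)
definition noerlund2_m1 :: "nat \<Rightarrow> real" where
  "noerlund2_m1 n = (-1) ^ n / (real n + 1)"

end

theory Submission
  imports Defs
begin

text \<open>The generating function is the geometric series of ratio \<open>- X / 2\<close>; the factor \<open>n + 1\<close> in
  the denominator of the Noerlund number is exactly what turns \<open>(n + 1)!\<close> back into \<open>n!\<close>.\<close>

lemma two_over_two_plus_X: "2 / (2 + fps_X) = Abs_fps (\<lambda>n. (- 1 / 2 :: real) ^ n)"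
proof -
  have unit: "fps_nth (2 + fps_X :: real fps) 0 \<noteq> 0"
    by simp
  have "Abs_fps (\<lambda>n. (- 1 / 2 :: real) ^ n) * (2 + fps_X) = 2"
  proof (rule fps_ext)
    fix n
    show "fps_nth (Abs_fps (\<lambda>n. (- 1 / 2 :: real) ^ n) * (2 + fps_X)) n = fps_nth 2 n"
      by (cases n) (simp_all add: distrib_left fps_numeral_nth mult.commute[of _ "2 :: real fps"]
          numeral_fps_const)
  qed
  moreover from unit have "2 + fps_X \<noteq> (0 :: real fps)"
    by (metis fps_zero_nth)
  ultimately show ?thesis
    by (metis nonzero_mult_div_cancel_right)
qed

theorem mainTheorem8:
  fixes n :: nat
  shows "changhee n = fact (n + 1) / 2 ^ n * noerlund2_m1 n"
proof -
  have "changhee n = fact n * ((- 1) ^ n / 2 ^ n)"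
    unfolding changhee_def two_over_two_plus_X fps_nth_Abs_fps power_divide ..
  also have "fact n = (fact (n + 1) / (real n + 1) :: real)"
    by (simp add: add.commute)
  also have "\<dots> * ((- 1) ^ n / 2 ^ n) = fact (n + 1) / 2 ^ n * ((- 1) ^ n / (real n + 1))"
    by (simp only: times_divide_times_eq mult.commute)
  finally show ?thesis
    by (simp add: noerlund2_m1_def)
qed

end
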